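(* Suppose that $\delta_n^\infty=o_p(r_n)$, and that there exists $t>0$ such that $\delta_n^\infty\{B_t(\theta_0)\}=o_p(r_n^{1/2})$. Then $$r_n^{1/2}(\tilde\theta_n-\theta_0)\to N\bigl(0,I(\theta_0)^{-1}\bigr)$$ in distribution as $n\to\infty$.
   Context: A sequence of statistical models indexed by $n$ has common parameter $\theta\in\Theta\subseteq\mathbb{R}^p$. For observed data $y$ under model $n$, $\ell_n(\theta)=\ell_n(\theta;y)$ is the log-likelihood, $u_n(\theta)=\nabla_\theta\ell_n(\theta)$ the score and $J_n(\theta)=-\nabla_\theta^T\nabla_\theta\ell_n(\theta)$ the observed information. The data are generated from the model for some $\theta_0\in\Theta$. As $n\to\infty$, the amount of information provided by the data about the parameter grows at some rate $r_n$, such that $J_n(\theta_0)=O_p(r_n)$. $I(\theta)$ is the Fisher information matrix, chosen such that $\bar J_n(\theta)=r_n^{-1}J_n(\theta)\to I(\theta)$ in probability. An approximate log-likelihood $\tilde\ell_n(\theta)=\tilde\ell_n(\theta;y)$, which may be any function of the parameters, is used in place of $\ell_n$. Both $\ell_n$ and $\tilde\ell_n$ are three times differentiable in $\theta$. Write $\tilde u_n=\nabla_\theta\tilde\ell_n$. The estimators $\hat\theta_n$ and $\tilde\theta_n$ maximize $\ell_n$ and $\tilde\ell_n$ respectively, and solve $u_n(\hat\theta_n)=0$ and $\tilde u_n(\tilde\theta_n)=0$. The vector norm is $\|a\|=\sum_i|a_i|$. For $S\subseteq\Theta$, $\delta_n^\infty(S)=\sup_{\theta\in S}\|\tilde u_n(\theta)-u_n(\theta)\|$,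 with $\delta_n^\infty=\delta_n^\infty(\Theta)$, and $B_t(\theta_0)=\{\theta\in\Theta:\|\theta-\theta_0\|\le t\}$. Standing regularity conditions: with $\bar u_n(\theta)=r_n^{-1}u_n(\theta)$ and $\bar u(\theta)$ its limit as $n\to\infty$, $\sup_{\theta\in\Theta}\|\bar u_n(\theta)-\bar u(\theta)\|\to0$ in probability, and for every $\epsilon>0$, $\inf_{\theta\in\Theta:\,\|\theta-\theta_0\|\ge\epsilon}\|\bar u(\theta)\|>0$, while $\bar u(\theta_0)=0$. The exact maximum likelihood estimator has its usual limit: $r_n^{1/2}(\hat\theta_n-\theta_0)\to N(0,I(\theta_0)^{-1})$ in distribution.
   Formalization: Added: J̄_n is, with probability tending to 1, uniformly close to I(θ0) on small balls around θ0 (pointwise convergence alone admits counterexamples with spurious maximizers drifting to θ0); θ0 is interior to Θ and I(θ0) is positive definite. *)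

theory Defs
  imports "HOL-Probability.Probability"
begin

section \<open>Derivatives of a log-likelihood\<close>

definition norm1 :: "real ^ 'p \<Rightarrow> real" where
  "norm1 a = (\<Sum>i\<in>UNIV. \<bar>a $ i\<bar>)"

definition gradient :: "(real ^ 'p \<Rightarrow> real) \<Rightarrow> real ^ 'p \<Rightarrow> real ^ 'p" where
  "gradient f x = (\<chi> i. frechet_derivative f (at x) (axis i 1))"

definition hessian :: "(real ^ 'p \<Rightarrow> real) \<Rightarrow> real ^ 'p \<Rightarrow> real ^ 'p ^ 'p" where
  "hessian f x = jacobian (gradient f) (at x)"

text \<open>Since \<open>frechet_derivative\<close> is an arbitrary linear map at points of non-differentiability,
  the conditions are imposed on an open neighbourhood of \<open>S\<close>; the set \<open>S\<close> itself
  need not be open.\<close>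

definition three_times_differentiable_on :: "(real ^ 'p \<Rightarrow> real) \<Rightarrow> (real ^ 'p) set \<Rightarrow> bool" where
  "three_times_differentiable_on f S \<longleftrightarrow>
     (\<exists>U. open U \<and> S \<subseteq> U \<and>
        (\<forall>x\<in>U. f differentiable (at x) \<and> gradient f differentiable (at x) \<and>
               hessian f differentiable (at x)))"

section \<open>Sequences of statistical models\<close>

text \<open>Model \<open>n\<close> has a dominating measure \<open>\<mu> n\<close> and densities \<open>f n \<theta>\<close>. Positivity makes
  the log-likelihood finite; \<open>space (\<mu> n)\<close> is the common support of model \<open>n\<close>. The functions
  \<open>L n \<theta> y\<close> below are an exact or an approximate log-likelihood.\<close>

definition model_law ::
  "(nat \<Rightarrow> 'y measure) \<Rightarrow> (nat \<Rightarrow> real ^ 'p \<Rightarrow> 'y \<Rightarrow> real) \<Rightarrow> nat \<Rightarrow> real ^ 'p \<Rightarrow> 'y measure" where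
  "model_law \<mu> f n \<theta> = density (\<mu> n) (\<lambda>y. ennreal (f n \<theta> y))"

definition statistical_models ::
  "(nat \<Rightarrow> 'y measure) \<Rightarrow> (nat \<Rightarrow> real ^ 'p \<Rightarrow> 'y \<Rightarrow> real) \<Rightarrow> (real ^ 'p) set \<Rightarrow> bool" where
  "statistical_models \<mu> f \<Theta> \<longleftrightarrow>
     (\<forall>n. \<forall>\<theta>\<in>\<Theta>. f n \<theta> \<in> borel_measurable (\<mu> n) \<and> (\<forall>y\<in>space (\<mu> n). 0 < f n \<theta> y) \<and>
                 prob_space (model_law \<mu> f n \<theta>))"

definition log_lik ::
  "(nat \<Rightarrow> real ^ 'p \<Rightarrow> 'y \<Rightarrow> real) \<Rightarrow> nat \<Rightarrow> real ^ 'p \<Rightarrow> 'y \<Rightarrow> real" where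
  "log_lik f n \<theta> y = ln (f n \<theta> y)"

definition score ::
  "(nat \<Rightarrow> real ^ 'p \<Rightarrow> 'y \<Rightarrow> real) \<Rightarrow> nat \<Rightarrow> real ^ 'p \<Rightarrow> 'y \<Rightarrow> real ^ 'p" where
  "score L n \<theta> y = gradient (\<lambda>\<theta>. L n \<theta> y) \<theta>"

definition obs_info ::
  "(nat \<Rightarrow> real ^ 'p \<Rightarrow> 'y \<Rightarrow> real) \<Rightarrow> nat \<Rightarrow> real ^ 'p \<Rightarrow> 'y \<Rightarrow> real ^ 'p ^ 'p" where
  "obs_info L n \<theta> y = - hessian (\<lambda>\<theta>. L n \<theta> y) \<theta>"

definition param_ball :: "(real ^ 'p) set \<Rightarrow> real \<Rightarrow> real ^ 'p \<Rightarrow> (real ^ 'p) set" where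
  "param_ball \<Theta> t \<theta>\<^sub>0 = {\<theta>\<in>\<Theta>. norm1 (\<theta> - \<theta>\<^sub>0) \<le> t}"

text \<open>Suprema are taken in \<open>ennreal\<close>, so that they are \<open>\<infinity>\<close> when unbounded.\<close>

definition score_error ::
  "(nat \<Rightarrow> real ^ 'p \<Rightarrow> 'y \<Rightarrow> real) \<Rightarrow> (nat \<Rightarrow> real ^ 'p \<Rightarrow> 'y \<Rightarrow> real) \<Rightarrow>
   (real ^ 'p) set \<Rightarrow> nat \<Rightarrow> 'y \<Rightarrow> ennreal" where
  "score_error L' L S n y = (SUP \<theta>\<in>S. ennreal (norm1 (score L' n \<theta> y - score L n \<theta> y)))"

definition max_estimator ::
  "(nat \<Rightarrow> 'y measure) \<Rightarrow> (nat \<Rightarrow> real ^ 'p \<Rightarrow> 'y \<Rightarrow> real) \<Rightarrow> (real ^ 'p) set \<Rightarrow>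
   (nat \<Rightarrow> 'y \<Rightarrow> real ^ 'p) \<Rightarrow> bool" where
  "max_estimator \<mu> L \<Theta> T \<longleftrightarrow>
     (\<forall>n. T n \<in> borel_measurable (\<mu> n) \<and>
        (\<forall>y\<in>space (\<mu> n). T n y \<in> \<Theta> \<and> (\<forall>\<theta>\<in>\<Theta>. L n \<theta> y \<le> L n (T n y) y) \<and>
                        score L n (T n y) y = 0))"

section \<open>Stochastic orders and convergence\<close>

text \<open>The exceedance events are measured by the outer measure, which is the measure itself when
  they are measurable; so no measurability of suprema, nor of the approximate
  log-likelihood as a function of the data, is presupposed. The sequence \<open>X\<close> is \<open>o\<^sub>p(r)\<close>
  or \<open>O\<^sub>p(r)\<close> under the laws \<open>P n\<close>, and \<open>X\<close> tends to \<open>0\<close> in probability iff it is \<open>o\<^sub>p(1)\<close>.\<close>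

definition small_op ::
  "(nat \<Rightarrow> 'y measure) \<Rightarrow> (nat \<Rightarrow> 'y \<Rightarrow> ennreal) \<Rightarrow> (nat \<Rightarrow> real) \<Rightarrow> bool" where
  "small_op P X r \<longleftrightarrow>
     (\<forall>\<epsilon>>0. (\<lambda>n. outer_measure_of (P n) {y\<in>space (P n). ennreal (\<epsilon> * r n) < X n y})
             \<longlonglongrightarrow> 0)"

definition big_op ::
  "(nat \<Rightarrow> 'y measure) \<Rightarrow> (nat \<Rightarrow> 'y \<Rightarrow> ennreal) \<Rightarrow> (nat \<Rightarrow> real) \<Rightarrow> bool" where
  "big_op P X r \<longleftrightarrow>
     (\<forall>\<epsilon>>0. \<exists>K. \<forall>\<^sub>F n in sequentially.
        outer_measure_of (P n) {y\<in>space (P n). ennreal (K * r n) < X n y} \<le> ennreal \<epsilon>)"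

definition tendsto_zero_in_prob ::
  "(nat \<Rightarrow> 'y measure) \<Rightarrow> (nat \<Rightarrow> 'y \<Rightarrow> ennreal) \<Rightarrow> bool" where
  "tendsto_zero_in_prob P X \<longleftrightarrow> small_op P X (\<lambda>_. 1)"

text \<open>The library's \<open>weak_conv_m\<close> covers real-valued variables only.\<close>

definition tendsto_in_distribution ::
  "(nat \<Rightarrow> 'y measure) \<Rightarrow> (nat \<Rightarrow> 'y \<Rightarrow> real ^ 'p) \<Rightarrow> (real ^ 'p) measure \<Rightarrow> bool" where
  "tendsto_in_distribution P X N \<longleftrightarrow>
     (\<forall>n. X n \<in> borel_measurable (P n)) \<and>
     (\<forall>g :: real ^ 'p \<Rightarrow> real. continuous_on UNIV g \<and> bounded (range g) \<longrightarrow>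
        (\<lambda>n. \<integral>y. g (X n y) \<partial>P n) \<longlonglongrightarrow> (\<integral>x. g x \<partial>N))"

section \<open>The multivariate normal distribution\<close>

definition positive_definite :: "real ^ 'p ^ 'p \<Rightarrow> bool" where
  "positive_definite A \<longleftrightarrow> transpose A = A \<and> (\<forall>x. x \<noteq> 0 \<longrightarrow> 0 < x \<bullet> (A *v x))"

text \<open>The normal distribution with mean \<open>m\<close> and positive definite covariance matrix \<open>\<Sigma>\<close>.\<close>

definition multivariate_normal :: "real ^ 'p \<Rightarrow> real ^ 'p ^ 'p \<Rightarrow> (real ^ 'p) measure" where
  "multivariate_normal m \<Sigma> =
     density lborel (\<lambda>x. ennreal (exp (- ((x - m) \<bullet> (matrix_inv \<Sigma> *v (x - m))) / 2)
                                  / sqrt ((2 * pi) ^ CARD('p) * det \<Sigma>)))"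

section \<open>Limiting information\<close>

text \<open>Fisher information at \<open>\<theta>\<close> is the limit of the normalised observed information when the
  data come from the model with parameter \<open>\<theta>\<close>.\<close>

definition fisher_information ::
  "(nat \<Rightarrow> 'y measure) \<Rightarrow> (nat \<Rightarrow> real ^ 'p \<Rightarrow> 'y \<Rightarrow> real) \<Rightarrow> (nat \<Rightarrow> real) \<Rightarrow>
   (real ^ 'p) set \<Rightarrow> (real ^ 'p \<Rightarrow> real ^ 'p ^ 'p) \<Rightarrow> bool" where
  "fisher_information \<mu> f r \<Theta> I \<longleftrightarrow>
     (\<forall>\<theta>\<in>\<Theta>. tendsto_zero_in_prob (\<lambda>n. model_law \<mu> f n \<theta>)
        (\<lambda>n y. ennreal (norm ((1 / r n) *\<^sub>R obs_info (log_lik f) n \<theta> y - I \<theta>))))"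

text \<open>Convergence of the normalised observed information to \<open>I\<^sub>0\<close> as \<open>n \<rightarrow> \<infinity>\<close> and
  \<open>\<theta> \<rightarrow> \<theta>\<^sub>0\<close> jointly. Convergence at each fixed \<open>\<theta>\<close> would allow perturbations
  of the log-likelihood, at locations moving towards \<open>\<theta>\<^sub>0\<close>, that produce maximisers at distance
  of larger order than \<open>r n powr (-1/2)\<close>.\<close>

definition local_information_limit ::
  "(nat \<Rightarrow> 'y measure) \<Rightarrow> (nat \<Rightarrow> real ^ 'p \<Rightarrow> 'y \<Rightarrow> real) \<Rightarrow> (nat \<Rightarrow> real) \<Rightarrow>
   (real ^ 'p) set \<Rightarrow> real ^ 'p \<Rightarrow> real ^ 'p ^ 'p \<Rightarrow> bool" where
  "local_information_limit P L r \<Theta> \<theta>\<^sub>0 I\<^sub>0 \<longleftrightarrow>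
     (\<forall>\<epsilon>>0. \<exists>s>0.
        (\<lambda>n. outer_measure_of (P n) {y\<in>space (P n).
           ennreal \<epsilon> < (SUP \<theta>\<in>param_ball \<Theta> s \<theta>\<^sub>0.
                         ennreal (norm ((1 / r n) *\<^sub>R obs_info L n \<theta> y - I\<^sub>0)))}) \<longlonglongrightarrow> 0)"

end

theory Submission
  imports Defs
begin

text \<open>Identifiability of \<open>\<theta>\<^sub>0\<close> and the two uniform score approximations force the exact and
  the approximate maximiser into any given ball around \<open>\<theta>\<^sub>0\<close>. On a small ball the normalised
  score plus \<open>I(\<theta>\<^sub>0) \<theta>\<close> is Lipschitz with a small constant, by the mean value inequality and the
  local convergence of the observed information. As \<open>I(\<theta>\<^sub>0)\<close> is bounded below, the distance
  of the two estimators is therefore at most a constant times the normalised exact score at the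
  approximate estimator, which is \<open>o\<^sub>p(r\<^sub>n\<^sup>1\<^sup>/\<^sup>2) / r\<^sub>n\<close> by the local score error. Slutsky's lemma
  then transfers the limit law.\<close>

section \<open>Slutsky's lemma\<close>

text \<open>Exceptional events need not be measurable, so a union bound is required for arbitrary
  sets. It is inherited from measurable covers that attain the outer measures.\<close>

lemma outer_measure_of_Un_le:
  "outer_measure_of M (A \<union> B) \<le> outer_measure_of M A + outer_measure_of M B"
proof (cases "A \<subseteq> space M \<and> B \<subseteq> space M")
  case True
  then obtain E F where E: "E \<in> sets M" "A \<subseteq> E" "outer_measure_of M A = emeasure M E"
    and F: "F \<in> sets M" "B \<subseteq> F" "outer_measure_of M B = emeasure M F"
    using outer_measure_of_attain by metis
  have "outer_measure_of M (A \<union> B) \<le> outer_measure_of M (E \<union> F)"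
    using E F by (intro outer_measure_of_mono) auto
  also have "\<dots> = emeasure M (E \<union> F)"
    using E F by simp
  also have "\<dots> \<le> emeasure M E + emeasure M F"
    using E F by (intro emeasure_subadditive)
  finally show ?thesis
    using E F by simp
next
  case False
  \<comment> \<open>A set that leaves the space has no measurable cover; its outer measure is an
    infimum over the empty set, hence infinite, and the bound is trivial.\<close>
  then have "{S \<in> sets M. A \<subseteq> S} = {} \<or> {S \<in> sets M. B \<subseteq> S} = {}"
    using sets.sets_into_space by blast
  then have "outer_measure_of M A = \<infinity> \<or> outer_measure_of M B = \<infinity>"
    by (auto simp only: outer_measure_of_def image_empty Inf_empty infinity_ennreal_def)
  then show ?thesis
    by auto
qed

lemma outer_measure_Un_tendsto_0:
  assumes "(\<lambda>n. outer_measure_of (P n) (A n)) \<longlonglongrightarrow> 0"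
    and "(\<lambda>n. outer_measure_of (P n) (B n)) \<longlonglongrightarrow> 0"
  shows "(\<lambda>n. outer_measure_of (P n) (A n \<union> B n)) \<longlonglongrightarrow> 0"
proof (rule tendsto_sandwich[OF _ _ tendsto_const])
  show "(\<lambda>n. outer_measure_of (P n) (A n) + outer_measure_of (P n) (B n)) \<longlonglongrightarrow> 0"
    using tendsto_add[OF assms] by simp
qed (auto intro!: always_eventually outer_measure_of_Un_le)

lemma outer_measure_subset_tendsto_0:
  assumes "(\<lambda>n. outer_measure_of (P n) (B n)) \<longlonglongrightarrow> 0"
    and "\<forall>\<^sub>F n in sequentially. A n \<subseteq> B n"
  shows "(\<lambda>n. outer_measure_of (P n) (A n)) \<longlonglongrightarrow> 0"
  by (rule tendsto_sandwich[OF _ _ tendsto_const assms(1)])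
     (auto intro: eventually_mono[OF assms(2)] outer_measure_of_mono)

section \<open>Tightness, and transfer of limit laws\<close>

text \<open>The indicator of a large norm lies below a bounded continuous ramp. The integral of the
  ramp under \<open>N\<close> is small by dominated convergence, and convergence in distribution
  carries this over to \<open>P n\<close> for large \<open>n\<close>.\<close>

lemma tendsto_in_distribution_tight:
  fixes N :: "(real ^ 'p) measure"
  assumes prob: "\<And>n. prob_space (P n)"
    and lim: "tendsto_in_distribution P X N"
    and sets: "sets N = sets borel"
    and "0 < e"
  obtains M where "\<forall>\<^sub>F n in sequentially. measure (P n) {y\<in>space (P n). M < norm (X n y)} < e"
proof -
  have X: "X n \<in> borel_measurable (P n)" for n
    using lim by (simp add: tendsto_in_distribution_def)
  have conv: "(\<lambda>n. \<integral>y. g (X n y) \<partial>P n) \<longlonglongrightarrow> (\<integral>x. g x \<partial>N)"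
    if "continuous_on UNIV g" "bounded (range g)" for g :: "real ^ 'p \<Rightarrow> real"
    using lim that by (simp add: tendsto_in_distribution_def)
  \<comment> \<open>The constant test function passes total mass one to the limit. Since
    \<open>measure\<close> is 0 on sets of infinite mass, the value 1 also shows that
    \<open>N\<close> is finite.\<close>
  have "(\<lambda>n. measure (P n) (space (P n))) \<longlonglongrightarrow> measure N (space N)"
    using conv[of "\<lambda>_. 1"] by simp
  then have "measure N (space N) = 1"
    using prob by (simp add: prob_space.prob_space LIMSEQ_const_iff)
  then have N: "prob_space N"
    by (metis emeasure_eq_ennreal_measure ennreal_1 measure_zero_top prob_spaceI zero_neq_one)
  interpret N: prob_space N
    by fact
  note [measurable_cong] = sets
  \<comment> \<open>The ramp is 0 up to radius \<open>M\<close> and 1 from radius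
    \<open>M + 1\<close> on, which is why the tail event below starts at
    \<open>M + 1\<close>.\<close>
  define \<phi> :: "nat \<Rightarrow> real ^ 'p \<Rightarrow> real" where "\<phi> M x = max 0 (min 1 (norm x - real M))" for M x
  have "(\<lambda>M. \<integral>x. \<phi> M x \<partial>N) \<longlonglongrightarrow> (\<integral>x. 0 \<partial>N)"
  proof (rule integral_dominated_convergence[where w = "\<lambda>_. 1"])
    show "AE x in N. (\<lambda>M. \<phi> M x) \<longlonglongrightarrow> 0"
    proof (rule AE_I2)
      fix x :: "real ^ 'p"
      have "\<forall>\<^sub>F M in sequentially. norm x \<le> real M"
        using eventually_ge_at_top[of "nat \<lceil>norm x\<rceil>"] by eventually_elim linarith
      then have "\<forall>\<^sub>F M in sequentially. \<phi> M x = 0"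
        by eventually_elim (simp add: \<phi>_def)
      then show "(\<lambda>M. \<phi> M x) \<longlonglongrightarrow> 0"
        by (rule tendsto_eventually)
    qed
  qed (auto simp: \<phi>_def)
  then have "\<forall>\<^sub>F M in sequentially. (\<integral>x. \<phi> M x \<partial>N) < e"
    using \<open>0 < e\<close> by (simp add: order_tendsto_iff)
  then obtain M where M: "(\<integral>x. \<phi> M x \<partial>N) < e"
    by (auto simp: eventually_sequentially)
  have "continuous_on UNIV (\<phi> M)"
    unfolding \<phi>_def by (intro continuous_intros)
  moreover have "bounded (range (\<phi> M))"
    by (rule boundedI[of _ 1]) (auto simp: \<phi>_def)
  ultimately have "\<forall>\<^sub>F n in sequentially. (\<integral>y. \<phi> M (X n y) \<partial>P n) < e"
    by (rule order_tendstoD(2)[OF conv M])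
  then have "\<forall>\<^sub>F n in sequentially. measure (P n) {y\<in>space (P n). real M + 1 < norm (X n y)} < e"
  proof eventually_elim
    case (elim n)
    interpret prob_space "P n"
      by (rule prob)
    note X[measurable]
    have "measure (P n) {y\<in>space (P n). real M + 1 < norm (X n y)}
        = (\<integral>y. indicator {y\<in>space (P n). real M + 1 < norm (X n y)} y \<partial>P n)"
      by simp
    also have "\<dots> \<le> (\<integral>y. \<phi> M (X n y) \<partial>P n)"
    proof (rule integral_mono)
      show "integrable (P n) (indicat_real {y\<in>space (P n). real M + 1 < norm (X n y)})"
        by (intro integrable_real_indicator) (auto simp: emeasure_eq_measure)
      show "integrable (P n) (\<lambda>y. \<phi> M (X n y))"
        by (rule integrable_const_bound[of _ 1]) (auto simp: \<phi>_def)
    qed (auto simp: \<phi>_def indicator_def)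
    finally show ?case
      using elim by simp
  qed
  then show thesis
    by (rule that)
qed

text \<open>Unless \<open>X n\<close> is large or \<open>Y n\<close> is far from \<open>X n\<close>,
  both points lie in a fixed compact ball, on which the test function \<open>g\<close> is uniformly
  continuous. The two exceptional events have small probability by tightness and by
  \<open>diff\<close>, and there the boundedness of \<open>g\<close> suffices.\<close>

lemma slutsky:
  fixes N :: "(real ^ 'p) measure"
  assumes prob: "\<And>n. prob_space (P n)"
    and lim: "tendsto_in_distribution P X N"
    and sets: "sets N = sets borel"
    and Y: "\<And>n. Y n \<in> borel_measurable (P n)"
    and diff: "tendsto_zero_in_prob P (\<lambda>n y. ennreal (norm (Y n y - X n y)))"
  shows "tendsto_in_distribution P Y N"
  unfolding tendsto_in_distribution_def
proof (intro conjI allI impI, rule Y, elim conjE)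
  fix g :: "real ^ 'p \<Rightarrow> real"
  assume cont: "continuous_on UNIV g" and "bounded (range g)"
  then obtain B where B: "\<And>x. \<bar>g x\<bar> \<le> B" "0 < B"
    by (auto simp: bounded_pos)
  have X: "X n \<in> borel_measurable (P n)" for n
    using lim by (simp add: tendsto_in_distribution_def)
  note [measurable] = X Y borel_measurable_continuous_onI[OF cont]
  have X_lim: "(\<lambda>n. \<integral>y. g (X n y) \<partial>P n) \<longlonglongrightarrow> (\<integral>x. g x \<partial>N)"
    using lim cont \<open>bounded (range g)\<close> by (simp add: tendsto_in_distribution_def)
  have "(\<lambda>n. (\<integral>y. g (Y n y) \<partial>P n) - (\<integral>y. g (X n y) \<partial>P n)) \<longlonglongrightarrow> 0"
  proof (rule tendstoI)
    fix e :: real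
    assume "0 < e"
    \<comment> \<open>Chosen so that the good event contributes at most \<eta> and each of the two
      bad events less than \<open>2 * B * \<eta>\<close>, with total \<open>e\<close>.\<close>
    define \<eta> where "\<eta> = e / (1 + 4 * B)"
    have "0 < \<eta>"
      using \<open>0 < e\<close> B by (simp add: \<eta>_def)
    obtain M where M: "\<forall>\<^sub>F n in sequentially. measure (P n) {y\<in>space (P n). M < norm (X n y)} < \<eta>"
      using tendsto_in_distribution_tight[OF prob lim sets \<open>0 < \<eta>\<close>] .
    have "uniformly_continuous_on (cball 0 (M + 1)) g"
      using cont by (intro compact_uniformly_continuous continuous_on_subset[OF cont]) auto
    then obtain d where d: "0 < d"
      "\<And>x z. \<lbrakk>x \<in> cball 0 (M + 1); z \<in> cball 0 (M + 1); dist z x < d\<rbrakk> \<Longrightarrow> dist (g z) (g x) < \<eta>"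
      using \<open>0 < \<eta>\<close> unfolding uniformly_continuous_on_def by metis
    \<comment> \<open>Strictly below \<open>d\<close>, because off the bad event only a non-strict
      bound on the distance holds; at most 1, so that \<open>Y n y\<close> stays in the ball of
      radius \<open>M + 1\<close>.\<close>
    define d' where "d' = min (d / 2) 1"
    have "0 < d'"
      using d by (simp add: d'_def)
    have "(\<lambda>n. outer_measure_of (P n) {y\<in>space (P n). ennreal (d' * 1) < ennreal (norm (Y n y - X n y))})
        \<longlonglongrightarrow> 0"
      using diff \<open>0 < d'\<close> unfolding tendsto_zero_in_prob_def small_op_def by blast
    \<comment> \<open>Both sequences are measurable, so the outer measure of this event is its
      measure.\<close>
    then have "(\<lambda>n. emeasure (P n) {y\<in>space (P n). d' < norm (Y n y - X n y)}) \<longlonglongrightarrow> 0"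
      using \<open>0 < d'\<close> by (simp add: ennreal_less_iff)
    then have "\<forall>\<^sub>F n in sequentially.
        emeasure (P n) {y\<in>space (P n). d' < norm (Y n y - X n y)} < ennreal \<eta>"
      using \<open>0 < \<eta>\<close> by (simp add: order_tendsto_iff)
    with M show "\<forall>\<^sub>F n in sequentially.
        dist ((\<integral>y. g (Y n y) \<partial>P n) - (\<integral>y. g (X n y) \<partial>P n)) 0 < e"
    proof eventually_elim
      case (elim n)
      interpret prob_space "P n"
        by (rule prob)
      define S where "S = {y\<in>space (P n). M < norm (X n y)}"
      define D where "D = {y\<in>space (P n). d' < norm (Y n y - X n y)}"
      have [measurable]: "S \<in> events" "D \<in> events"
        unfolding S_def D_def by measurable
      have small: "prob S < \<eta>" "prob D < \<eta>"
        using elim \<open>0 < \<eta>\<close> by (auto simp: S_def D_def emeasure_eq_measure ennreal_less_iff)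
      have [simp]: "integrable (P n) (indicat_real S)" "integrable (P n) (indicat_real D)"
        by (auto intro: integrable_real_indicator simp: emeasure_eq_measure)
      have int: "integrable (P n) (\<lambda>y. g (Y n y))" "integrable (P n) (\<lambda>y. g (X n y))"
        using B by (auto intro!: integrable_const_bound[of _ B])
      have pointwise: "\<bar>g (Y n y) - g (X n y)\<bar> \<le> \<eta> + 2 * B * indicator S y + 2 * B * indicator D y"
        if "y \<in> space (P n)" for y
      proof (cases "y \<in> S \<union> D")
        case True
        have "\<bar>g (Y n y) - g (X n y)\<bar> \<le> 2 * B"
          using B(1)[of "Y n y"] B(1)[of "X n y"] by linarith
        with True B(2) \<open>0 < \<eta>\<close> show ?thesis
          by (auto simp: indicator_def)
      next
        case False
        then have "norm (X n y) \<le> M" "norm (Y n y - X n y) \<le> d'"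
          using that by (auto simp: S_def D_def)
        moreover from this have "norm (Y n y) \<le> M + 1"
          using norm_triangle_sub[of "Y n y" "X n y"] by (auto simp: d'_def)
        moreover have "d' < d"
          using d by (auto simp: d'_def)
        ultimately have "dist (g (Y n y)) (g (X n y)) < \<eta>"
          by (intro d) (auto simp: dist_norm)
        with False show ?thesis
          by (auto simp: dist_real_def)
      qed
      have "\<bar>(\<integral>y. g (Y n y) \<partial>P n) - (\<integral>y. g (X n y) \<partial>P n)\<bar> = \<bar>\<integral>y. g (Y n y) - g (X n y) \<partial>P n\<bar>"
        using int by simp
      also have "\<dots> \<le> (\<integral>y. \<bar>g (Y n y) - g (X n y)\<bar> \<partial>P n)"
        by (rule integral_abs_bound)
      also have "\<dots> \<le> (\<integral>y. \<eta> + 2 * B * indicator S y + 2 * B * indicator D y \<partial>P n)"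
        using int pointwise
        by (intro integral_mono Bochner_Integration.integrable_add integrable_mult_right) auto
      also have "\<dots> = \<eta> + 2 * B * prob S + 2 * B * prob D"
        by (simp add: prob_space)
      also have "\<dots> < \<eta> + 2 * B * \<eta> + 2 * B * \<eta>"
        using small B(2) by (intro add_strict_mono add_strict_left_mono mult_strict_left_mono) auto
      also have "\<dots> = \<eta> * (1 + 4 * B)"
        by (simp add: algebra_simps)
      also have "\<dots> = e"
        using B(2) by (simp add: \<eta>_def)
      finally show ?case
        by simp
    qed
  qed
  from tendsto_add[OF this X_lim] show "(\<lambda>n. \<integral>y. g (Y n y) \<partial>P n) \<longlonglongrightarrow> (\<integral>x. g x \<partial>N)"
    by simp
qed

section \<open>Deterministic bounds\<close>

lemma norm1_nonneg [simp]: "0 \<le> norm1 a"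
  by (simp add: norm1_def sum_nonneg)

lemma norm1_triangle: "norm1 (a + b) \<le> norm1 a + norm1 b"
  unfolding norm1_def sum.distrib[symmetric] by (intro sum_mono) (simp add: abs_triangle_ineq)

lemma norm1_scaleR: "norm1 (c *\<^sub>R a) = \<bar>c\<bar> * norm1 a"
  by (simp add: norm1_def abs_mult sum_distrib_left)

lemma norm1_minus: "norm1 (- a) = norm1 a"
  by (simp add: norm1_def)

lemma norm_le_norm1: "norm a \<le> norm1 a"
  unfolding norm1_def by (rule norm_le_l1_cart)

lemma norm1_le_norm: "norm1 (a :: real ^ 'p) \<le> real CARD('p) * norm a"
  unfolding norm1_def by (rule sum_bounded_above) (rule component_le_norm_cart)

text \<open>Here \<open>norm A\<close> is the Frobenius norm, the Euclidean norm of the vector of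
  row norms, so Cauchy-Schwarz applies row by row.\<close>

lemma norm_matrix_vector_mult_le:
  fixes A :: "real ^ 'n ^ 'm"
  shows "norm (A *v x) \<le> norm A * norm x"
proof -
  have "norm (A *v x) = L2_set (\<lambda>i. A $ i \<bullet> x) UNIV"
    by (simp add: norm_vec_def L2_set_def matrix_mult_dot row_def vec_lambda_eta)
  also have "\<dots> = L2_set (\<lambda>i. \<bar>A $ i \<bullet> x\<bar>) UNIV"
    by (simp add: L2_set_def)
  also have "\<dots> \<le> L2_set (\<lambda>i. norm (A $ i) * norm x) UNIV"
    by (intro L2_set_mono) (auto simp: Cauchy_Schwarz_ineq2)
  also have "\<dots> = norm A * norm x"
    by (simp add: L2_set_left_distrib norm_vec_def)
  finally show ?thesis .
qed

section \<open>Linearisation of the score\<close>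

text \<open>This is the mean value inequality for the scaled gradient plus the linear map
  \<open>A\<close>: the derivative of that sum is minus the matrix bounded in \<open>close\<close>.
  Below, \<open>c\<close> is the inverse rate and \<open>A\<close> the limiting information.\<close>

lemma gradient_increment_bound:
  fixes l :: "real ^ 'p \<Rightarrow> real"
  assumes "convex S"
    and diff: "\<And>\<theta>. \<theta> \<in> S \<Longrightarrow> gradient l differentiable (at \<theta>)"
    and close: "\<And>\<theta>. \<theta> \<in> S \<Longrightarrow> norm (c *\<^sub>R (- hessian l \<theta>) - A) \<le> \<epsilon>"
    and "x \<in> S" "z \<in> S"
  shows "norm (c *\<^sub>R (gradient l x - gradient l z) + A *v (x - z)) \<le> \<epsilon> * norm (x - z)"
proof -
  define F where "F \<theta> = c *\<^sub>R gradient l \<theta> + A *v \<theta>" for \<theta>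
  have "(F has_derivative (\<lambda>h. (c *\<^sub>R hessian l \<theta> + A) *v h)) (at \<theta> within S)"
    if "\<theta> \<in> S" for \<theta>
  proof -
    have "(gradient l has_derivative (\<lambda>h. hessian l \<theta> *v h)) (at \<theta> within S)"
      unfolding hessian_def using jacobian_works diff that by (blast intro: has_derivative_at_withinI)
    moreover have "((\<lambda>\<theta>. A *v \<theta>) has_derivative (\<lambda>h. A *v h)) (at \<theta> within S)"
      by (rule bounded_linear_imp_has_derivative) (rule matrix_vector_mul_bounded_linear)
    ultimately have "(F has_derivative (\<lambda>h. c *\<^sub>R (hessian l \<theta> *v h) + A *v h)) (at \<theta> within S)"
      unfolding F_def by (intro has_derivative_add has_derivative_scaleR_right)
    then show ?thesis
      by (simp add: matrix_vector_mult_add_rdistrib scaleR_matrix_vector_assoc)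
  qed
  moreover have "onorm (\<lambda>h. (c *\<^sub>R hessian l \<theta> + A) *v h) \<le> \<epsilon>" if "\<theta> \<in> S" for \<theta>
  proof (rule onorm_le)
    fix h
    have "norm ((c *\<^sub>R hessian l \<theta> + A) *v h) \<le> norm (c *\<^sub>R hessian l \<theta> + A) * norm h"
      by (rule norm_matrix_vector_mult_le)
    also have "norm (c *\<^sub>R hessian l \<theta> + A) = norm (c *\<^sub>R (- hessian l \<theta>) - A)"
      using norm_minus_cancel[of "c *\<^sub>R hessian l \<theta> + A"] by simp
    also have "\<dots> * norm h \<le> \<epsilon> * norm h"
      using close[OF that] by (intro mult_right_mono) auto
    finally show "norm ((c *\<^sub>R hessian l \<theta> + A) *v h) \<le> \<epsilon> * norm h" .
  qed
  ultimately have "norm (F x - F z) \<le> \<epsilon> * norm (x - z)"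
    using assms by (intro differentiable_bound)
  also have "F x - F z = c *\<^sub>R (gradient l x - gradient l z) + A *v (x - z)"
    by (simp add: F_def algebra_simps matrix_vector_mult_diff_distrib)
  finally show ?thesis .
qed

text \<open>A nonzero kernel vector would contradict positivity of the quadratic form, and an
  injective linear map in finite dimension is bounded below.\<close>

lemma positive_definite_bounded_below:
  assumes "positive_definite A"
  obtains c where "0 < c" "\<And>x. c * norm x \<le> norm (A *v x)"
proof -
  have "inj ((*v) A)"
    using assms by (auto simp: positive_definite_def linear_injective_0)
  then show thesis
    by (rule linear_inj_bounded_below_pos[OF matrix_vector_mul_linear]) (rule that)
qed

text \<open>The linearisation error absorbs only half of the lower bound for \<open>A\<close>. The
  other half bounds \<open>x - z\<close> by a multiple of the score at \<open>x\<close> divided by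
  \<open>r\<close>; multiplication by \<open>sqrt r\<close> then cancels the remaining powers of
  \<open>r\<close>.\<close>

lemma zeros_close_of_small_score:
  fixes l :: "real ^ 'p \<Rightarrow> real"
  assumes "convex S"
    and diff: "\<And>\<theta>. \<theta> \<in> S \<Longrightarrow> gradient l differentiable (at \<theta>)"
    and close: "\<And>\<theta>. \<theta> \<in> S \<Longrightarrow> norm ((1 / r) *\<^sub>R (- hessian l \<theta>) - A) \<le> c / 2"
    and below: "\<And>x. c * norm x \<le> norm (A *v x)"
    and "0 < c" "0 < r"
    and "x \<in> S" "z \<in> S" "gradient l z = 0"
    and score: "norm (gradient l x) \<le> \<eta> * sqrt r"
  shows "norm (sqrt r *\<^sub>R (x - z)) \<le> 2 * \<eta> / c"
proof -
  have "norm ((1 / r) *\<^sub>R gradient l x + A *v (x - z)) \<le> c / 2 * norm (x - z)"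
    using gradient_increment_bound[OF \<open>convex S\<close> diff close \<open>x \<in> S\<close> \<open>z \<in> S\<close>] \<open>gradient l z = 0\<close>
    by simp
  moreover have "c * norm (x - z) \<le> norm (A *v (x - z))"
    by (rule below)
  moreover have "norm (A *v (x - z)) \<le>
      norm ((1 / r) *\<^sub>R gradient l x + A *v (x - z)) + norm ((1 / r) *\<^sub>R gradient l x)"
    by (metis add_diff_cancel_left' norm_triangle_ineq4)
  moreover have "norm ((1 / r) *\<^sub>R gradient l x) = norm (gradient l x) / r"
    using \<open>0 < r\<close> by simp
  ultimately have "c / 2 * norm (x - z) \<le> norm (gradient l x) / r"
    by linarith
  also have "\<dots> \<le> \<eta> * sqrt r / r"
    using score \<open>0 < r\<close> by (simp add: divide_right_mono)
  finally have "sqrt r * (c / 2 * norm (x - z)) \<le> sqrt r * (\<eta> * sqrt r / r)"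
    using \<open>0 < r\<close> by (intro mult_left_mono) auto
  also have "\<dots> = \<eta>"
    using \<open>0 < r\<close> by (simp add: field_simps)
  finally show ?thesis
    unfolding norm_scaleR using \<open>0 < c\<close> \<open>0 < r\<close> by (simp add: field_simps)
qed

section \<open>Identifiability and score errors\<close>

lemma identifiable_small_imp_close:
  assumes "0 < (INF \<theta>\<in>{\<theta>\<in>\<Theta>. \<epsilon> \<le> norm1 (\<theta> - \<theta>\<^sub>0)}. ennreal (norm1 (ubar \<theta>)))"
  obtains \<eta> where "0 < \<eta>"
    "\<And>\<theta>. \<lbrakk>\<theta> \<in> \<Theta>; norm1 (ubar \<theta>) \<le> \<eta>\<rbrakk> \<Longrightarrow> norm1 (\<theta> - \<theta>\<^sub>0) < \<epsilon>"
proof -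
  \<comment> \<open>The infimum itself may be infinite, for instance over an empty set; a value
    strictly below it is a finite threshold in every case.\<close>
  obtain z where z: "0 < z" "z < (INF \<theta>\<in>{\<theta>\<in>\<Theta>. \<epsilon> \<le> norm1 (\<theta> - \<theta>\<^sub>0)}. ennreal (norm1 (ubar \<theta>)))"
    using dense[OF assms] by blast
  then have "z \<noteq> top"
    by (auto dest: less_imp_neq less_le_trans[OF _ top_greatest])
  then obtain \<eta> where \<eta>: "z = ennreal \<eta>" "0 \<le> \<eta>"
    using ennreal_cases by blast
  show thesis
  proof
    show "0 < \<eta>"
      using z(1) \<eta>(1) by simp
    fix \<theta>
    assume "\<theta> \<in> \<Theta>" "norm1 (ubar \<theta>) \<le> \<eta>"
    show "norm1 (\<theta> - \<theta>\<^sub>0) < \<epsilon>"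
    proof (rule ccontr)
      assume "\<not> ?thesis"
      with \<open>\<theta> \<in> \<Theta>\<close> have "\<theta> \<in> {\<theta>\<in>\<Theta>. \<epsilon> \<le> norm1 (\<theta> - \<theta>\<^sub>0)}"
        by simp
      with z(2) have "ennreal \<eta> < ennreal (norm1 (ubar \<theta>))"
        unfolding \<eta>(1) by (rule less_INF_D)
      with \<eta> \<open>norm1 (ubar \<theta>) \<le> \<eta>\<close> show False
        by (simp add: ennreal_less_iff)
    qed
  qed
qed

text \<open>Where the score of \<open>L'\<close> vanishes, the score error at that point is the
  score of \<open>L\<close> up to sign.\<close>

lemma score_error_leD:
  assumes "score_error L' L S n y \<le> ennreal b" "0 \<le> b" "\<theta> \<in> S" "score L' n \<theta> y = 0"
  shows "norm1 (score L n \<theta> y) \<le> b"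
proof -
  have "ennreal (norm1 (score L' n \<theta> y - score L n \<theta> y)) \<le> ennreal b"
    using assms(1,3) unfolding score_error_def SUP_le_iff by (rule bspec)
  with assms show ?thesis
    by (simp add: norm1_minus)
qed

section \<open>The limit law\<close>

theorem theorem2:
  fixes \<mu> :: "nat \<Rightarrow> 'y measure"
    and f :: "nat \<Rightarrow> real ^ 'p \<Rightarrow> 'y \<Rightarrow> real"
    and \<Theta> :: "(real ^ 'p) set"
    and \<theta>\<^sub>0 :: "real ^ 'p"
    and r :: "nat \<Rightarrow> real"
    and I :: "real ^ 'p \<Rightarrow> real ^ 'p ^ 'p"
    and approx_log_lik :: "nat \<Rightarrow> real ^ 'p \<Rightarrow> 'y \<Rightarrow> real"
    and ubar :: "real ^ 'p \<Rightarrow> real ^ 'p"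
    and mle approx_mle :: "nat \<Rightarrow> 'y \<Rightarrow> real ^ 'p"
    and P :: "nat \<Rightarrow> 'y measure"
  defines "P \<equiv> \<lambda>n. model_law \<mu> f n \<theta>\<^sub>0"
  assumes models: "statistical_models \<mu> f \<Theta>"
    and true_param: "\<theta>\<^sub>0 \<in> interior \<Theta>"
    and smooth: "\<And>n y. y \<in> space (\<mu> n) \<Longrightarrow>
          three_times_differentiable_on (\<lambda>\<theta>. log_lik f n \<theta> y) \<Theta>"
    and approx_smooth: "\<And>n y. y \<in> space (\<mu> n) \<Longrightarrow>
          three_times_differentiable_on (\<lambda>\<theta>. approx_log_lik n \<theta> y) \<Theta>"
    and rate_pos: "\<And>n. 0 < r n"
    and rate: "filterlim r at_top sequentially"
    and info_order: "big_op P (\<lambda>n y. ennreal (norm (obs_info (log_lik f) n \<theta>\<^sub>0 y))) r"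
    and fisher: "fisher_information \<mu> f r \<Theta> I"
    and fisher_local: "local_information_limit P (log_lik f) r \<Theta> \<theta>\<^sub>0 (I \<theta>\<^sub>0)"
    and fisher_pd: "positive_definite (I \<theta>\<^sub>0)"
    and mle: "max_estimator \<mu> (log_lik f) \<Theta> mle"
    and approx_mle: "max_estimator \<mu> approx_log_lik \<Theta> approx_mle"
    and score_limit: "tendsto_zero_in_prob P
          (\<lambda>n y. SUP \<theta>\<in>\<Theta>. ennreal (norm1 ((1 / r n) *\<^sub>R score (log_lik f) n \<theta> y - ubar \<theta>)))"
    and identifiable: "\<And>\<epsilon>. 0 < \<epsilon> \<Longrightarrow>
          0 < (INF \<theta>\<in>{\<theta>\<in>\<Theta>. \<epsilon> \<le> norm1 (\<theta> - \<theta>\<^sub>0)}. ennreal (norm1 (ubar \<theta>)))"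
    and ubar_zero: "ubar \<theta>\<^sub>0 = 0"
    and mle_limit: "tendsto_in_distribution P (\<lambda>n y. sqrt (r n) *\<^sub>R (mle n y - \<theta>\<^sub>0))
          (multivariate_normal 0 (matrix_inv (I \<theta>\<^sub>0)))"
    and global_error: "small_op P (score_error approx_log_lik (log_lik f) \<Theta>) r"
    and local_error: "\<exists>t>0. small_op P
          (score_error approx_log_lik (log_lik f) (param_ball \<Theta> t \<theta>\<^sub>0)) (\<lambda>n. sqrt (r n))"
  shows "tendsto_in_distribution P (\<lambda>n y. sqrt (r n) *\<^sub>R (approx_mle n y - \<theta>\<^sub>0))
          (multivariate_normal 0 (matrix_inv (I \<theta>\<^sub>0)))"
proof -
  have P_space [simp]: "space (P n) = space (\<mu> n)" and P_sets: "sets (P n) = sets (\<mu> n)" for n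
    by (simp_all add: P_def model_law_def)
  have "\<theta>\<^sub>0 \<in> \<Theta>"
    using true_param interior_subset by blast
  then have prob: "prob_space (P n)" for n
    using models by (simp add: statistical_models_def P_def)
  have est: "mle n y \<in> \<Theta>" "score (log_lik f) n (mle n y) y = 0"
    "approx_mle n y \<in> \<Theta>" "score approx_log_lik n (approx_mle n y) y = 0"
    if "y \<in> space (\<mu> n)" for n y
    using mle approx_mle that by (auto simp: max_estimator_def)
  have "approx_mle n \<in> borel_measurable (\<mu> n)" for n
    using approx_mle by (simp add: max_estimator_def)
  then have [measurable]: "approx_mle n \<in> borel_measurable (P n)" for n
    by (simp add: measurable_cong_sets[OF P_sets refl])
  obtain t where "0 < t" and local_err: "small_op P
      (score_error approx_log_lik (log_lik f) (param_ball \<Theta> t \<theta>\<^sub>0)) (\<lambda>n. sqrt (r n))"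
    using local_error by blast
  obtain c where c: "0 < c" "\<And>x. c * norm x \<le> norm (I \<theta>\<^sub>0 *v x)"
    using positive_definite_bounded_below[OF fisher_pd] by metis
  obtain s where "0 < s" and info: "(\<lambda>n. outer_measure_of (P n) {y\<in>space (P n). ennreal (c / 2)
      < (SUP \<theta>\<in>param_ball \<Theta> s \<theta>\<^sub>0. ennreal (norm ((1 / r n) *\<^sub>R obs_info (log_lik f) n \<theta> y - I \<theta>\<^sub>0)))})
      \<longlonglongrightarrow> 0"
    using fisher_local[unfolded local_information_limit_def, rule_format, OF half_gt_zero[OF c(1)]]
    by blast
  \<comment> \<open>The mean value bound needs a convex set. A Euclidean ball inside \<Theta> is
    convex, whereas \<open>param_ball\<close> is cut off by \<Theta> and may fail to be.\<close>
  obtain q where "0 < q" "cball \<theta>\<^sub>0 q \<subseteq> \<Theta>"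
    using true_param mem_interior_cball by metis
  \<comment> \<open>The radius keeps the ball within \<Theta> (\<open>q\<close>), within reach of
    the local score error (\<open>t\<close>) and of the local information limit (\<open>s\<close>).
    The dimension enters because \<open>norm1\<close> may exceed the Euclidean norm by that
    factor.\<close>
  define \<rho> where "\<rho> = min q (min t (s / real CARD('p)))"
  have "\<rho> \<le> s / real CARD('p)"
    by (simp add: \<rho>_def)
  then have \<rho>: "0 < \<rho>" "\<rho> \<le> q" "\<rho> \<le> t" "real CARD('p) * \<rho> \<le> s"
    using \<open>0 < q\<close> \<open>0 < t\<close> \<open>0 < s\<close> by (auto simp: \<rho>_def le_divide_eq mult.commute)
  have ball: "cball \<theta>\<^sub>0 \<rho> \<subseteq> param_ball \<Theta> s \<theta>\<^sub>0"
  proof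
    fix \<theta>
    assume \<theta>: "\<theta> \<in> cball \<theta>\<^sub>0 \<rho>"
    then have "norm (\<theta> - \<theta>\<^sub>0) \<le> \<rho>"
      by (simp add: dist_norm norm_minus_commute)
    then have "norm1 (\<theta> - \<theta>\<^sub>0) \<le> real CARD('p) * \<rho>"
      by (meson norm1_le_norm mult_left_mono of_nat_0_le_iff order_trans)
    then show "\<theta> \<in> param_ball \<Theta> s \<theta>\<^sub>0"
      using \<theta> \<rho> \<open>cball \<theta>\<^sub>0 q \<subseteq> \<Theta>\<close> by (auto simp: param_ball_def)
  qed
  obtain \<kappa> where \<kappa>: "0 < \<kappa>"
    "\<And>\<theta>. \<lbrakk>\<theta> \<in> \<Theta>; norm1 (ubar \<theta>) \<le> \<kappa>\<rbrakk> \<Longrightarrow> norm1 (\<theta> - \<theta>\<^sub>0) < \<rho>"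
    using identifiable_small_imp_close[OF identifiable[OF \<rho>(1)]] by metis
  have "tendsto_zero_in_prob P (\<lambda>n y. ennreal (norm (sqrt (r n) *\<^sub>R (approx_mle n y - \<theta>\<^sub>0)
      - sqrt (r n) *\<^sub>R (mle n y - \<theta>\<^sub>0))))"
    unfolding tendsto_zero_in_prob_def small_op_def
  proof (intro allI impI)
    fix e :: real
    assume "0 < e"
    \<comment> \<open>Makes the final bound \<open>2 * \<eta> / c\<close> equal to
      \<open>e\<close>.\<close>
    define \<eta> where "\<eta> = c * e / 2"
    have "0 < \<eta>"
      using c \<open>0 < e\<close> by (simp add: \<eta>_def)
    \<comment> \<open>Off \<open>E1\<close> and \<open>E2\<close>, two errors of
      \<open>\<kappa> / 2\<close> add up to the identifiability threshold \<kappa>. Off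
      \<open>E3\<close> the exact score is small at the approximate estimator once that estimator is
      known to be local; off \<open>E4\<close> the linearisation is valid.\<close>
    define E1 where "E1 n = {y\<in>space (P n). ennreal (\<kappa> / 2 * 1)
      < (SUP \<theta>\<in>\<Theta>. ennreal (norm1 ((1 / r n) *\<^sub>R score (log_lik f) n \<theta> y - ubar \<theta>)))}" for n
    define E2 where "E2 n = {y\<in>space (P n). ennreal (\<kappa> / 2 * r n)
      < score_error approx_log_lik (log_lik f) \<Theta> n y}" for n
    define E3 where "E3 n = {y\<in>space (P n). ennreal (\<eta> * sqrt (r n))
      < score_error approx_log_lik (log_lik f) (param_ball \<Theta> t \<theta>\<^sub>0) n y}" for n
    define E4 where "E4 n = {y\<in>space (P n). ennreal (c / 2)
      < (SUP \<theta>\<in>param_ball \<Theta> s \<theta>\<^sub>0. ennreal (norm ((1 / r n) *\<^sub>R obs_info (log_lik f) n \<theta> y - I \<theta>\<^sub>0)))}" for n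
    have "(\<lambda>n. outer_measure_of (P n) (E1 n)) \<longlonglongrightarrow> 0"
      unfolding E1_def
      using score_limit[unfolded tendsto_zero_in_prob_def small_op_def, rule_format,
          OF half_gt_zero[OF \<kappa>(1)]] .
    moreover have "(\<lambda>n. outer_measure_of (P n) (E2 n)) \<longlonglongrightarrow> 0"
      unfolding E2_def using global_error[unfolded small_op_def, rule_format, OF half_gt_zero[OF \<kappa>(1)]] .
    moreover have "(\<lambda>n. outer_measure_of (P n) (E3 n)) \<longlonglongrightarrow> 0"
      unfolding E3_def using local_err[unfolded small_op_def, rule_format, OF \<open>0 < \<eta>\<close>] .
    moreover have "(\<lambda>n. outer_measure_of (P n) (E4 n)) \<longlonglongrightarrow> 0"
      unfolding E4_def by (rule info)
    ultimately have vanish: "(\<lambda>n. outer_measure_of (P n) (E1 n \<union> E2 n \<union> E3 n \<union> E4 n)) \<longlonglongrightarrow> 0"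
      by (intro outer_measure_Un_tendsto_0)
    \<comment> \<open>From here the argument is deterministic, for a fixed data point outside the
      four events.\<close>
    have "norm (sqrt (r n) *\<^sub>R (approx_mle n y - mle n y)) \<le> e"
      if y: "y \<in> space (\<mu> n)" "y \<notin> E1 n \<union> E2 n \<union> E3 n \<union> E4 n" for n y
    proof -
      have unif: "norm1 ((1 / r n) *\<^sub>R score (log_lik f) n \<theta> y - ubar \<theta>) \<le> \<kappa> / 2" if "\<theta> \<in> \<Theta>" for \<theta>
        using y that \<kappa>(1) by (auto simp: E1_def not_less SUP_le_iff)
      \<comment> \<open>Stated for any parameter whose exact score is small, so that it localises
        both estimators: the exact score is 0 at one and bounded by the global score error at the
        other.\<close>
      have near: "\<theta> \<in> cball \<theta>\<^sub>0 \<rho>" "\<theta> \<in> param_ball \<Theta> t \<theta>\<^sub>0"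
        if "\<theta> \<in> \<Theta>" "norm1 (score (log_lik f) n \<theta> y) \<le> \<kappa> / 2 * r n" for \<theta>
      proof -
        define v where "v = (1 / r n) *\<^sub>R score (log_lik f) n \<theta> y"
        have "norm1 v \<le> \<kappa> / 2"
          using that rate_pos[of n] by (simp add: v_def norm1_scaleR field_simps)
        moreover have "norm1 (ubar \<theta> - v) \<le> \<kappa> / 2"
          using unif[OF that(1)] norm1_minus[of "ubar \<theta> - v"] by (simp add: v_def)
        ultimately have "norm1 (ubar \<theta>) \<le> \<kappa>"
          using norm1_triangle[of "ubar \<theta> - v" v] by simp
        then have "norm1 (\<theta> - \<theta>\<^sub>0) < \<rho>"
          using \<kappa> that by blast
        then show "\<theta> \<in> cball \<theta>\<^sub>0 \<rho>" "\<theta> \<in> param_ball \<Theta> t \<theta>\<^sub>0"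
          using norm_le_norm1[of "\<theta> - \<theta>\<^sub>0"] \<rho> that
          by (auto simp: dist_norm norm_minus_commute param_ball_def)
      qed
      have "norm1 (score (log_lik f) n (approx_mle n y) y) \<le> \<kappa> / 2 * r n"
        using y est[OF y(1)] \<kappa>(1) rate_pos[of n]
        by (intro score_error_leD[of approx_log_lik "log_lik f" \<Theta>]) (auto simp: E2_def not_less)
      then have approx_near: "approx_mle n y \<in> cball \<theta>\<^sub>0 \<rho>" "approx_mle n y \<in> param_ball \<Theta> t \<theta>\<^sub>0"
        using near est[OF y(1)] by blast+
      have mle_near: "mle n y \<in> cball \<theta>\<^sub>0 \<rho>"
        using near(1)[of "mle n y"] est[OF y(1)] \<kappa>(1) rate_pos[of n] by (simp add: norm1_def)
      \<comment> \<open>The approximate estimator is already known to lie in the smaller parameter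
        ball, so the sharper local score error now replaces the global one.\<close>
      have small: "norm (score (log_lik f) n (approx_mle n y) y) \<le> \<eta> * sqrt (r n)"
        using y est[OF y(1)] \<open>0 < \<eta>\<close> rate_pos[of n] approx_near(2)
        by (intro order_trans[OF norm_le_norm1]
              score_error_leD[of approx_log_lik "log_lik f" "param_ball \<Theta> t \<theta>\<^sub>0"])
           (auto simp: E3_def not_less)
      have "norm (sqrt (r n) *\<^sub>R (approx_mle n y - mle n y)) \<le> 2 * \<eta> / c"
      proof (rule zeros_close_of_small_score[where S = "cball \<theta>\<^sub>0 \<rho>" and A = "I \<theta>\<^sub>0"
            and l = "\<lambda>\<theta>. log_lik f n \<theta> y"])
        fix \<theta>
        assume \<theta>: "\<theta> \<in> cball \<theta>\<^sub>0 \<rho>"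
        with ball have "\<theta> \<in> param_ball \<Theta> s \<theta>\<^sub>0"
          by blast
        then show "gradient (\<lambda>\<theta>. log_lik f n \<theta> y) differentiable (at \<theta>)"
          using smooth[OF y(1)] unfolding three_times_differentiable_on_def param_ball_def by blast
        show "norm ((1 / r n) *\<^sub>R (- hessian (\<lambda>\<theta>. log_lik f n \<theta> y) \<theta>) - I \<theta>\<^sub>0) \<le> c / 2"
          using y c(1) \<open>\<theta> \<in> param_ball \<Theta> s \<theta>\<^sub>0\<close>
          by (auto simp: E4_def not_less SUP_le_iff obs_info_def)
      qed (use c rate_pos[of n] mle_near approx_near small est[OF y(1)] in \<open>auto simp: score_def\<close>)
      also have "\<dots> = e"
        using c by (simp add: \<eta>_def)
      finally show ?thesis .
    qed
    then have "{y\<in>space (P n). ennreal (e * 1) < ennreal (norm (sqrt (r n) *\<^sub>R (approx_mle n y - \<theta>\<^sub>0)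
        - sqrt (r n) *\<^sub>R (mle n y - \<theta>\<^sub>0)))} \<subseteq> E1 n \<union> E2 n \<union> E3 n \<union> E4 n" for n
      using \<open>0 < e\<close> by (force simp: ennreal_less_iff scaleR_diff_right[symmetric] not_le[symmetric])
    then show "(\<lambda>n. outer_measure_of (P n) {y\<in>space (P n). ennreal (e * 1)
        < ennreal (norm (sqrt (r n) *\<^sub>R (approx_mle n y - \<theta>\<^sub>0) - sqrt (r n) *\<^sub>R (mle n y - \<theta>\<^sub>0)))})
        \<longlonglongrightarrow> 0"
      by (intro outer_measure_subset_tendsto_0[OF vanish] always_eventually allI)
  qed
  then show ?thesis
    by (intro slutsky[OF prob mle_limit]) (simp_all add: multivariate_normal_def)
qed

end
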